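(* Let $n\ge 1$, let $x_1\neq x_2$ be two vectors in $\mathbb{R}^n$, let $\alpha,\beta>0$, and let $Q_1,Q_2\in\mathbb{R}^{n\times n}$ be two symmetric positive definite matrices. Consider the bi-objective minimization problem $(f_1,f_2)$ on $\mathbb{R}^n$ with $$f_1(x)=\frac1\alpha (x-x_1)^\top Q_1(x-x_1),\qquad f_2(x)=\frac1\beta (x-x_2)^\top Q_2(x-x_2).$$ Then the Pareto set of $(f_1,f_2)$ is the image of the function $\varphi:[0,1]\to\mathbb{R}^n$ defined by $$\varphi(t)=\left[(1-t)Q_1+tQ_2\right]^{-1}\left[(1-t)Q_1x_1+tQ_2x_2\right].$$ The function $\varphi$ is differentiable and satisfies, for every $t\in[0,1]$, $$(1-t)Q_1\left(\varphi(t)-x_1\right)=tQ_2\left(x_2-\varphi(t)\right),$$ $$t\left[(1-t)Q_1+tQ_2\right]\varphi'(t)=Q_1\left(\varphi(t)-x_1\right).$$ Hence, the Pareto set is a continuous (differentiable) curve of $\mathbb{R}^n$ whose extremes are $x_1=\varphi(0)$ and $x_2=\varphi(1)$.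
   Context: The Pareto set of a bi-objective minimization problem $(f_1,f_2)$ on $\mathbb{R}^n$ is the set of all $x\in\mathbb{R}^n$ for which there is no $y\in\mathbb{R}^n$ with $f_1(y)\le f_1(x)$ and $f_2(y)\le f_2(x)$ and at least one of these inequalities strict. Differentiability on $[0,1]$ is understood as one-sided at the endpoints. *)

theory Defs
  imports "HOL-Analysis.Analysis"
begin

definition pareto_set :: "('a \<Rightarrow> real) \<Rightarrow> ('a \<Rightarrow> real) \<Rightarrow> 'a set" where
  "pareto_set f\<^sub>1 f\<^sub>2 =
     {x. \<not> (\<exists>y. f\<^sub>1 y \<le> f\<^sub>1 x \<and> f\<^sub>2 y \<le> f\<^sub>2 x \<and> (f\<^sub>1 y < f\<^sub>1 x \<or> f\<^sub>2 y < f\<^sub>2 x))}"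

definition sym_pos_def :: "real^'n^'n \<Rightarrow> bool" where
  "sym_pos_def Q \<longleftrightarrow> transpose Q = Q \<and> (\<forall>v. v \<noteq> 0 \<longrightarrow> v \<bullet> (Q *v v) > 0)"

definition quad_obj :: "real \<Rightarrow> real^'n^'n \<Rightarrow> real^'n \<Rightarrow> real^'n \<Rightarrow> real" where
  "quad_obj \<alpha> Q c x = (1 / \<alpha>) * ((x - c) \<bullet> (Q *v (x - c)))"

definition matrix_mix :: "real^'n^'n \<Rightarrow> real^'n^'n \<Rightarrow> real \<Rightarrow> real^'n^'n" where
  "matrix_mix Q\<^sub>1 Q\<^sub>2 t = (1 - t) *\<^sub>R Q\<^sub>1 + t *\<^sub>R Q\<^sub>2"

(* Only parameters t in [0,1] are meaningful; matrix_inv is unspecified on singular matrices. *)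
definition pareto_curve ::
    "real^'n^'n \<Rightarrow> real^'n^'n \<Rightarrow> real^'n \<Rightarrow> real^'n \<Rightarrow> real \<Rightarrow> real^'n" where
  "pareto_curve Q\<^sub>1 Q\<^sub>2 x\<^sub>1 x\<^sub>2 t =
     matrix_inv (matrix_mix Q\<^sub>1 Q\<^sub>2 t) *v ((1 - t) *\<^sub>R (Q\<^sub>1 *v x\<^sub>1) + t *\<^sub>R (Q\<^sub>2 *v x\<^sub>2))"

end

theory Submission
  imports Defs
begin

text \<open>
  The point \<open>\<phi> t\<close> is the unique minimizer of the strictly convex quadratic
  \<open>(1 - t) \<alpha> f\<^sub>1 + t \<beta> f\<^sub>2\<close>, hence Pareto optimal.
  Conversely, let \<open>a = Q\<^sub>1 (x - x\<^sub>1)\<close> and \<open>b = Q\<^sub>2 (x\<^sub>2 - x)\<close>.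
  If \<open>a \<bullet> b < |a| |b|\<close>, both objectives strictly decrease from \<open>x\<close> in the direction
  \<open>|a| b - |b| a\<close>; otherwise \<open>|b| a = |a| b\<close>, which says \<open>x = \<phi> t\<close> for
  \<open>t = |a| / (|a| + |b|)\<close>.
  Differentiability follows from the linear system defining \<open>\<phi>\<close>, because a common
  coercivity constant of \<open>Q\<^sub>1\<close> and \<open>Q\<^sub>2\<close> bounds the inverses of the mixed matrices uniformly in \<open>t\<close>.
\<close>

section \<open>Quadratic forms of symmetric positive definite matrices\<close>

lemma symmetric_matrix_inner:
  fixes Q :: "real^'n^'n"
  assumes "transpose Q = Q"
  shows "u \<bullet> (Q *v v) = (Q *v u) \<bullet> v"
  using dot_lmul_matrix[of u Q v] transpose_matrix_vector[of Q u] by (simp add: assms)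

lemma quadratic_form_add:
  fixes Q :: "real^'n^'n"
  assumes "transpose Q = Q"
  shows "(u + v) \<bullet> (Q *v (u + v)) = u \<bullet> (Q *v u) + 2 * ((Q *v u) \<bullet> v) + v \<bullet> (Q *v v)"
proof -
  have "v \<bullet> (Q *v u) = (Q *v u) \<bullet> v" "u \<bullet> (Q *v v) = (Q *v u) \<bullet> v"
    by (rule inner_commute, rule symmetric_matrix_inner[OF assms])
  then show ?thesis
    by (simp add: matrix_vector_right_distrib inner_add_left inner_add_right)
qed

lemma sym_pos_def_invertible:
  fixes Q :: "real^'n^'n"
  assumes "sym_pos_def Q"
  shows "invertible Q"
proof -
  have "x = 0" if "Q *v x = 0" for x
    using assms that unfolding sym_pos_def_def by (metis inner_zero_right less_irrefl)
  then show ?thesis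
    by (metis invertible_left_inverse matrix_left_invertible_ker)
qed

text \<open>The form attains a positive minimum on the compact unit sphere. Homogeneity of degree
  two carries this bound to every vector.\<close>

lemma sym_pos_def_coercive:
  fixes Q :: "real^'n^'n"
  assumes "sym_pos_def Q"
  shows "\<exists>m>0. \<forall>v. m * (norm v)\<^sup>2 \<le> v \<bullet> (Q *v v)"
proof -
  have cont: "continuous_on (sphere 0 1) (\<lambda>v::real^'n. v \<bullet> (Q *v v))"
    by (intro continuous_intros linear_continuous_on matrix_vector_mul_bounded_linear)
  have "sphere (0::real^'n) 1 \<noteq> {}"
    by simp
  from continuous_attains_inf[OF compact_sphere this cont] obtain u :: "real^'n" where u: "norm u = 1"
    and min: "\<And>v. norm v = 1 \<Longrightarrow> u \<bullet> (Q *v u) \<le> v \<bullet> (Q *v v)"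
    by auto
  show ?thesis
  proof (intro exI[of _ "u \<bullet> (Q *v u)"] conjI allI)
    have "u \<noteq> 0"
      using u by auto
    then show "u \<bullet> (Q *v u) > 0"
      using assms unfolding sym_pos_def_def by blast
    show "(u \<bullet> (Q *v u)) * (norm v)\<^sup>2 \<le> v \<bullet> (Q *v v)" for v
    proof (cases "v = 0")
      case False
      then have "u \<bullet> (Q *v u) \<le> (inverse (norm v) *\<^sub>R v) \<bullet> (Q *v (inverse (norm v) *\<^sub>R v))"
        by (intro min) simp
      also have "\<dots> = v \<bullet> (Q *v v) / (norm v)\<^sup>2"
        by (simp add: matrix_vector_mult_scaleR divide_inverse power2_eq_square)
      finally show ?thesis
        using False by (simp add: field_simps)
    qed simp
  qed
qed

lemma invertible_matrix_inv:
  fixes A :: "'a::semiring_1^'n^'m"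
  assumes "invertible A"
  shows "A ** matrix_inv A = mat 1" "matrix_inv A ** A = mat 1"
  using someI_ex[OF assms[unfolded invertible_def]] unfolding matrix_inv_def by blast+

section \<open>Convex combinations of the two matrices\<close>

lemma matrix_mix_mult:
  "matrix_mix Q\<^sub>1 Q\<^sub>2 t *v v = (1 - t) *\<^sub>R (Q\<^sub>1 *v v) + t *\<^sub>R (Q\<^sub>2 *v v)"
  by (simp add: matrix_mix_def matrix_vector_mult_add_rdistrib scaleR_matrix_vector_assoc)

text \<open>The smaller of the two coercivity constants survives every convex combination. One
  constant for all \<open>t\<close> is what makes the remainder estimate for the derivative
  uniform.\<close>

lemma matrix_mix_coercive:
  fixes Q\<^sub>1 Q\<^sub>2 :: "real^'n^'n"
  assumes "sym_pos_def Q\<^sub>1" "sym_pos_def Q\<^sub>2"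
  shows "\<exists>m>0. \<forall>t\<in>{0..1}. \<forall>v. m * (norm v)\<^sup>2 \<le> v \<bullet> (matrix_mix Q\<^sub>1 Q\<^sub>2 t *v v)"
proof -
  obtain m\<^sub>1 where m1: "m\<^sub>1 > 0" "\<And>v. m\<^sub>1 * (norm v)\<^sup>2 \<le> v \<bullet> (Q\<^sub>1 *v v)"
    using sym_pos_def_coercive[OF assms(1)] by blast
  obtain m\<^sub>2 where m2: "m\<^sub>2 > 0" "\<And>v. m\<^sub>2 * (norm v)\<^sup>2 \<le> v \<bullet> (Q\<^sub>2 *v v)"
    using sym_pos_def_coercive[OF assms(2)] by blast
  show ?thesis
  proof (intro exI[of _ "min m\<^sub>1 m\<^sub>2"] conjI ballI allI)
    show "min m\<^sub>1 m\<^sub>2 > 0"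
      using m1(1) m2(1) by simp
    fix t :: real and v :: "real^'n"
    assume t: "t \<in> {0..1}"
    let ?c = "min m\<^sub>1 m\<^sub>2 * (norm v)\<^sup>2"
    have "?c \<le> m\<^sub>1 * (norm v)\<^sup>2" "?c \<le> m\<^sub>2 * (norm v)\<^sup>2"
      by (rule mult_right_mono; simp)+
    then have "?c \<le> v \<bullet> (Q\<^sub>1 *v v)" "?c \<le> v \<bullet> (Q\<^sub>2 *v v)"
      using m1(2)[of v] m2(2)[of v] by linarith+
    then have "(1 - t) * ?c + t * ?c \<le> (1 - t) * (v \<bullet> (Q\<^sub>1 *v v)) + t * (v \<bullet> (Q\<^sub>2 *v v))"
      using t by (intro add_mono mult_left_mono) auto
    then show "?c \<le> v \<bullet> (matrix_mix Q\<^sub>1 Q\<^sub>2 t *v v)"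
      by (simp add: matrix_mix_mult inner_add_right algebra_simps)
  qed
qed

lemma sym_pos_def_matrix_mix:
  fixes Q\<^sub>1 Q\<^sub>2 :: "real^'n^'n"
  assumes "sym_pos_def Q\<^sub>1" "sym_pos_def Q\<^sub>2" "t \<in> {0..1}"
  shows "sym_pos_def (matrix_mix Q\<^sub>1 Q\<^sub>2 t)"
proof -
  obtain m where m: "m > 0"
    and coercive: "\<And>s v. s \<in> {0..1} \<Longrightarrow> m * (norm v)\<^sup>2 \<le> v \<bullet> (matrix_mix Q\<^sub>1 Q\<^sub>2 s *v v)"
    using matrix_mix_coercive[OF assms(1,2)] by blast
  have "v \<bullet> (matrix_mix Q\<^sub>1 Q\<^sub>2 t *v v) > 0" if "v \<noteq> 0" for v
  proof -
    have "0 < m * (norm v)\<^sup>2"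
      using m that by simp
    then show ?thesis
      using coercive[OF assms(3), of v] by linarith
  qed
  moreover have "transpose (matrix_mix Q\<^sub>1 Q\<^sub>2 t) = matrix_mix Q\<^sub>1 Q\<^sub>2 t"
    using assms(1,2) unfolding sym_pos_def_def matrix_mix_def
    by (simp add: transpose_def vec_eq_iff)
  ultimately show ?thesis
    unfolding sym_pos_def_def by blast
qed

section \<open>The curve as solution of a linear system, and its derivative\<close>

text \<open>Collecting the terms in \<open>x\<close> turns the equation into the invertible system
  \<open>?M *v x = ?c\<close>. The defining formula of the curve is unfolded only here; afterwards
  the curve is handled through this stationarity condition.\<close>

lemma pareto_curve_eq_iff:
  fixes Q\<^sub>1 Q\<^sub>2 :: "real^'n^'n"
  assumes "sym_pos_def Q\<^sub>1" "sym_pos_def Q\<^sub>2" "t \<in> {0..1}"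
  shows "x = pareto_curve Q\<^sub>1 Q\<^sub>2 x\<^sub>1 x\<^sub>2 t \<longleftrightarrow>
    (1 - t) *\<^sub>R (Q\<^sub>1 *v (x - x\<^sub>1)) = t *\<^sub>R (Q\<^sub>2 *v (x\<^sub>2 - x))"
proof -
  let ?M = "matrix_mix Q\<^sub>1 Q\<^sub>2 t"
  let ?c = "(1 - t) *\<^sub>R (Q\<^sub>1 *v x\<^sub>1) + t *\<^sub>R (Q\<^sub>2 *v x\<^sub>2)"
  have inv: "invertible ?M"
    using assms sym_pos_def_matrix_mix sym_pos_def_invertible by blast
  have "x = matrix_inv ?M *v ?c \<longleftrightarrow> ?M *v x = ?c"
    by (metis inv invertible_matrix_inv matrix_vector_mul_assoc matrix_vector_mul_lid)
  then show ?thesis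
    by (auto simp: pareto_curve_def matrix_mix_mult matrix_vector_mult_diff_distrib algebra_simps)
qed

text \<open>The equation for \<open>z\<close> is the formal derivative of the system
  \<open>?M t *v \<phi> t = ?c\<close>. It carries no factor \<open>t\<close> on the left, so it
  determines the derivative at \<open>t = 0\<close> too.\<close>

lemma pareto_curve_has_vector_derivative:
  fixes Q\<^sub>1 Q\<^sub>2 :: "real^'n^'n" and x\<^sub>1 x\<^sub>2 :: "real^'n"
  assumes "sym_pos_def Q\<^sub>1" "sym_pos_def Q\<^sub>2" "t \<in> {0..1}"
  defines "\<phi> \<equiv> pareto_curve Q\<^sub>1 Q\<^sub>2 x\<^sub>1 x\<^sub>2"
  shows "\<exists>z. (\<phi> has_vector_derivative z) (at t within {0..1}) \<and>
    matrix_mix Q\<^sub>1 Q\<^sub>2 t *v z = Q\<^sub>1 *v (\<phi> t - x\<^sub>1) + Q\<^sub>2 *v (x\<^sub>2 - \<phi> t)"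
proof -
  let ?M = "matrix_mix Q\<^sub>1 Q\<^sub>2"
  define w where "w = Q\<^sub>1 *v (\<phi> t - x\<^sub>1) + Q\<^sub>2 *v (x\<^sub>2 - \<phi> t)"
  define z where "z = matrix_inv (?M t) *v w"
  have "invertible (?M t)"
    using assms sym_pos_def_matrix_mix sym_pos_def_invertible by blast
  then have Mz: "?M t *v z = w"
    unfolding z_def by (metis invertible_matrix_inv matrix_vector_mul_assoc matrix_vector_mul_lid)
  have sys: "?M s *v \<phi> s = (1 - s) *\<^sub>R (Q\<^sub>1 *v x\<^sub>1) + s *\<^sub>R (Q\<^sub>2 *v x\<^sub>2)" if "s \<in> {0..1}" for s
    using pareto_curve_eq_iff[OF assms(1,2) that, of "\<phi> s" x\<^sub>1 x\<^sub>2]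
    by (auto simp: \<phi>_def matrix_mix_mult matrix_vector_mult_diff_distrib algebra_simps)
  obtain m where m: "m > 0"
    and coercive: "\<And>s v. s \<in> {0..1} \<Longrightarrow> m * (norm v)\<^sup>2 \<le> v \<bullet> (?M s *v v)"
    using matrix_mix_coercive[OF assms(1,2)] by blast
  \<comment> \<open>The first-order remainder \<open>e\<close> will satisfy \<open>?M s *v e = (s -
    t)\<^sup>2 *\<^sub>R ((Q\<^sub>1 - Q\<^sub>2) *v z)\<close>, and applying the inverse of
    \<open>?M s\<close> costs at most the factor \<open>1 / m\<close>.\<close>
  define C where "C = norm ((Q\<^sub>1 - Q\<^sub>2) *v z) / m"
  have C: "C \<ge> 0"
    using m by (simp add: C_def)
  have quad: "norm (\<phi> s - \<phi> t - (s - t) *\<^sub>R z) \<le> C * (s - t)\<^sup>2" if s: "s \<in> {0..1}" for s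
  proof -
    define e where "e = \<phi> s - \<phi> t - (s - t) *\<^sub>R z"
    \<comment> \<open>The mix is affine in its parameter, so this expansion is exact.\<close>
    have Mst: "?M s *v v = ?M t *v v - (s - t) *\<^sub>R ((Q\<^sub>1 - Q\<^sub>2) *v v)" for v
      by (simp add: matrix_mix_mult matrix_vector_mult_diff_rdistrib algebra_simps)
    have "?M s *v e = ?M s *v \<phi> s - ?M s *v \<phi> t - (s - t) *\<^sub>R (?M s *v z)"
      by (simp add: e_def matrix_vector_mult_diff_distrib matrix_vector_mult_scaleR)
    also have "?M s *v \<phi> s - ?M s *v \<phi> t = (s - t) *\<^sub>R w"
      unfolding Mst[of "\<phi> t"] sys[OF s] sys[OF assms(3)] w_def
      by (simp add: matrix_vector_mult_diff_rdistrib matrix_vector_mult_diff_distrib algebra_simps)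
    also have "?M s *v z = w - (s - t) *\<^sub>R ((Q\<^sub>1 - Q\<^sub>2) *v z)"
      unfolding Mst Mz ..
    finally have Me: "?M s *v e = (s - t)\<^sup>2 *\<^sub>R ((Q\<^sub>1 - Q\<^sub>2) *v z)"
      by (simp add: scaleR_diff_right power2_eq_square)
    \<comment> \<open>Coercivity tested at \<open>e\<close> itself, followed by Cauchy-Schwarz,
      bounds the remainder without any estimate of a matrix inverse.\<close>
    have "norm e * (m * norm e) \<le> e \<bullet> (?M s *v e)"
      using coercive[OF s, of e] by (simp add: power2_eq_square algebra_simps)
    also have "\<dots> \<le> norm e * norm (?M s *v e)"
      by (rule norm_cauchy_schwarz)
    finally have "m * norm e \<le> norm (?M s *v e)"
      by (cases "e = 0") simp_all
    then show ?thesis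
      unfolding e_def[symmetric] using m by (simp add: Me C_def field_simps)
  qed
  have "(\<phi> has_derivative (\<lambda>h. h *\<^sub>R z)) (at t within {0..1})"
    unfolding has_derivative_within_alt
  proof (intro conjI allI impI)
    show "bounded_linear (\<lambda>h. h *\<^sub>R z)"
      by (rule bounded_linear_scaleR_left)
    fix \<epsilon> :: real
    assume e: "\<epsilon> > 0"
    show "\<exists>d>0. \<forall>s\<in>{0..1}. norm (s - t) < d \<longrightarrow>
      norm (\<phi> s - \<phi> t - (s - t) *\<^sub>R z) \<le> \<epsilon> * norm (s - t)"
    \<comment> \<open>\<open>C\<close> may be zero, hence the denominator
      \<open>C + 1\<close>.\<close>
    proof (intro exI[of _ "\<epsilon> / (C + 1)"] conjI ballI impI)
      show "\<epsilon> / (C + 1) > 0"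
        using e C by simp
      fix s :: real
      assume s: "s \<in> {0..1}" and d: "norm (s - t) < \<epsilon> / (C + 1)"
      have "C * \<bar>s - t\<bar> \<le> (C + 1) * \<bar>s - t\<bar>"
        by (simp add: mult_right_mono)
      also have "\<dots> \<le> \<epsilon>"
        using d C by (simp add: field_simps)
      finally have "C * \<bar>s - t\<bar> * \<bar>s - t\<bar> \<le> \<epsilon> * \<bar>s - t\<bar>"
        by (rule mult_right_mono) simp
      then show "norm (\<phi> s - \<phi> t - (s - t) *\<^sub>R z) \<le> \<epsilon> * norm (s - t)"
        using quad[OF s] by (simp add: power2_eq_square mult.assoc)
    qed
  qed
  then show ?thesis
    using Mz unfolding has_vector_derivative_def w_def by blast
qed

section \<open>Pareto optimality of the points of the curve\<close>

lemma quad_obj_le_iff: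
  assumes "\<alpha> > 0"
  shows "quad_obj \<alpha> Q c y \<le> quad_obj \<alpha> Q c x \<longleftrightarrow>
    (y - c) \<bullet> (Q *v (y - c)) \<le> (x - c) \<bullet> (Q *v (x - c))"
  using assms by (simp add: quad_obj_def divide_le_cancel)

text \<open>Both objectives are expanded around \<open>x\<close> at \<open>y = x + v\<close> and
  weighted by \<open>1 - t\<close> and \<open>t\<close>. Stationarity cancels the first-order terms,
  leaving a positive definite form in \<open>v\<close> that cannot be nonpositive unless
  \<open>v = 0\<close>. So only \<open>x\<close> itself is at least as good as \<open>x\<close> in
  both objectives.\<close>

lemma pareto_curve_in_pareto_set:
  fixes Q\<^sub>1 Q\<^sub>2 :: "real^'n^'n"
  assumes "\<alpha> > 0" "\<beta> > 0" "sym_pos_def Q\<^sub>1" "sym_pos_def Q\<^sub>2" "t \<in> {0..1}"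
  shows "pareto_curve Q\<^sub>1 Q\<^sub>2 x\<^sub>1 x\<^sub>2 t \<in> pareto_set (quad_obj \<alpha> Q\<^sub>1 x\<^sub>1) (quad_obj \<beta> Q\<^sub>2 x\<^sub>2)"
proof -
  define x where "x = pareto_curve Q\<^sub>1 Q\<^sub>2 x\<^sub>1 x\<^sub>2 t"
  have sym: "transpose Q\<^sub>1 = Q\<^sub>1" "transpose Q\<^sub>2 = Q\<^sub>2"
    using assms(3,4) by (auto simp: sym_pos_def_def)
  have stat: "(1 - t) *\<^sub>R (Q\<^sub>1 *v (x - x\<^sub>1)) = t *\<^sub>R (Q\<^sub>2 *v (x\<^sub>2 - x))"
    using pareto_curve_eq_iff[OF assms(3-5)] x_def by blast
  have "y = x" if le1: "quad_obj \<alpha> Q\<^sub>1 x\<^sub>1 y \<le> quad_obj \<alpha> Q\<^sub>1 x\<^sub>1 x"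
    and le2: "quad_obj \<beta> Q\<^sub>2 x\<^sub>2 y \<le> quad_obj \<beta> Q\<^sub>2 x\<^sub>2 x" for y
  proof (rule ccontr)
    assume "y \<noteq> x"
    define v where "v = y - x"
    have v: "y - x\<^sub>1 = (x - x\<^sub>1) + v" "y - x\<^sub>2 = (x - x\<^sub>2) + v"
      by (simp_all add: v_def)
    have "2 * ((Q\<^sub>1 *v (x - x\<^sub>1)) \<bullet> v) + v \<bullet> (Q\<^sub>1 *v v) \<le> 0"
      "2 * ((Q\<^sub>2 *v (x - x\<^sub>2)) \<bullet> v) + v \<bullet> (Q\<^sub>2 *v v) \<le> 0"
      using le1 le2 unfolding quad_obj_le_iff[OF assms(1)] quad_obj_le_iff[OF assms(2)] v
        quadratic_form_add[OF sym(1)] quadratic_form_add[OF sym(2)] by linarith+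
    then have "(1 - t) * (2 * ((Q\<^sub>1 *v (x - x\<^sub>1)) \<bullet> v) + v \<bullet> (Q\<^sub>1 *v v)) +
        t * (2 * ((Q\<^sub>2 *v (x - x\<^sub>2)) \<bullet> v) + v \<bullet> (Q\<^sub>2 *v v)) \<le> 0"
      using add_nonpos_nonpos[OF mult_nonneg_nonpos mult_nonneg_nonpos] assms(5)
      by (meson atLeastAtMost_iff diff_ge_0_iff_ge)
    moreover have "(1 - t) * ((Q\<^sub>1 *v (x - x\<^sub>1)) \<bullet> v) + t * ((Q\<^sub>2 *v (x - x\<^sub>2)) \<bullet> v) = 0"
    proof -
      have "((1 - t) *\<^sub>R (Q\<^sub>1 *v (x - x\<^sub>1))) \<bullet> v = - (t *\<^sub>R (Q\<^sub>2 *v (x - x\<^sub>2))) \<bullet> v"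
        unfolding stat by (simp add: matrix_vector_mult_diff_distrib algebra_simps)
      then show ?thesis
        by simp
    qed
    ultimately have "v \<bullet> (matrix_mix Q\<^sub>1 Q\<^sub>2 t *v v) \<le> 0"
      by (simp add: matrix_mix_mult inner_add_right algebra_simps)
    moreover have "v \<noteq> 0"
      using \<open>y \<noteq> x\<close> by (simp add: v_def)
    ultimately show False
      using sym_pos_def_matrix_mix[OF assms(3-5)] unfolding sym_pos_def_def by fastforce
  qed
  then show ?thesis
    unfolding pareto_set_def x_def[symmetric] by blast
qed

section \<open>Descent directions and the converse inclusion\<close>

text \<open>The change along the ray is \<open>s * (2 * ?a + s * ?b)\<close> up to the factor
  \<open>1 / \<alpha>\<close>, and the negative \<open>?a\<close> dominates for small
  \<open>s\<close>. The filter form lets two objectives share a common step.\<close>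

lemma quad_obj_descent:
  fixes Q :: "real^'n^'n"
  assumes "\<alpha> > 0" "transpose Q = Q" "(Q *v (x - c)) \<bullet> v < 0"
  shows "\<forall>\<^sub>F s in at_right 0. quad_obj \<alpha> Q c (x + s *\<^sub>R v) < quad_obj \<alpha> Q c x"
proof -
  let ?a = "(Q *v (x - c)) \<bullet> v" and ?b = "v \<bullet> (Q *v v)"
  have "((\<lambda>s. 2 * ?a + s * ?b) \<longlongrightarrow> 2 * ?a + 0 * ?b) (at_right 0)"
    by (intro tendsto_intros)
  then have "\<forall>\<^sub>F s in at_right 0. 2 * ?a + s * ?b < 0"
    using assms(3) order_tendstoD(2)[of _ "2 * ?a + 0 * ?b" _ 0] by simp
  moreover have "\<forall>\<^sub>F s::real in at_right 0. s > 0"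
    by (rule eventually_at_right_less)
  ultimately show ?thesis
  proof eventually_elim
    case (elim s)
    have "x + s *\<^sub>R v - c = (x - c) + s *\<^sub>R v"
      by simp
    then have "(x + s *\<^sub>R v - c) \<bullet> (Q *v (x + s *\<^sub>R v - c)) =
        (x - c) \<bullet> (Q *v (x - c)) + s * (2 * ?a + s * ?b)"
      by (simp only: quadratic_form_add[OF assms(2)])
        (simp add: matrix_vector_mult_scaleR algebra_simps)
    also have "\<dots> < (x - c) \<bullet> (Q *v (x - c))"
      using elim by (simp add: mult_pos_neg)
    finally show ?case
      using assms(1) by (simp add: quad_obj_def divide_strict_right_mono)
  qed
qed

lemma pareto_set_in_pareto_curve:
  fixes Q\<^sub>1 Q\<^sub>2 :: "real^'n^'n"
  assumes "x\<^sub>1 \<noteq> x\<^sub>2" "\<alpha> > 0" "\<beta> > 0" "sym_pos_def Q\<^sub>1" "sym_pos_def Q\<^sub>2"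
    and x: "x \<in> pareto_set (quad_obj \<alpha> Q\<^sub>1 x\<^sub>1) (quad_obj \<beta> Q\<^sub>2 x\<^sub>2)"
  shows "x \<in> pareto_curve Q\<^sub>1 Q\<^sub>2 x\<^sub>1 x\<^sub>2 ` {0..1}"
proof -
  define a where "a = Q\<^sub>1 *v (x - x\<^sub>1)"
  define b where "b = Q\<^sub>2 *v (x\<^sub>2 - x)"
  have sym: "transpose Q\<^sub>1 = Q\<^sub>1" "transpose Q\<^sub>2 = Q\<^sub>2"
    using assms(4,5) by (auto simp: sym_pos_def_def)
  have "a \<bullet> b = norm a * norm b"
  proof (rule ccontr)
    assume "a \<bullet> b \<noteq> norm a * norm b"
    \<comment> \<open>If \<open>a\<close> or \<open>b\<close> were zero, Cauchy-Schwarz would be an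
      equality.\<close>
    then have lt: "a \<bullet> b < norm a * norm b" and ne: "a \<noteq> 0" "b \<noteq> 0"
      using norm_cauchy_schwarz[of a b] by auto
    \<comment> \<open>Up to positive factors, \<open>a\<close> and \<open>- b\<close> are the
      gradients of the two objectives. \<open>v\<close> is a positive multiple of the difference of
      the unit vectors along \<open>b\<close> and \<open>a\<close>, so it makes an obtuse angle with
      both gradients.\<close>
    define v where "v = norm a *\<^sub>R b - norm b *\<^sub>R a"
    have "a \<bullet> v = norm a * (a \<bullet> b - norm a * norm b)"
      by (simp add: v_def inner_diff_right dot_square_norm power2_eq_square algebra_simps)
    then have "(Q\<^sub>1 *v (x - x\<^sub>1)) \<bullet> v < 0"
      using lt ne by (simp add: a_def[symmetric] mult_pos_neg)
    moreover have "(Q\<^sub>2 *v (x - x\<^sub>2)) \<bullet> v < 0"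
    proof -
      have "Q\<^sub>2 *v (x - x\<^sub>2) = - b"
        by (simp add: b_def matrix_vector_mult_diff_distrib)
      moreover have "b \<bullet> v = norm b * (norm a * norm b - a \<bullet> b)"
        by (simp add: v_def inner_diff_right dot_square_norm power2_eq_square inner_commute
            algebra_simps)
      ultimately show ?thesis
        using lt ne by simp
    qed
    ultimately have "\<forall>\<^sub>F s in at_right 0.
        quad_obj \<alpha> Q\<^sub>1 x\<^sub>1 (x + s *\<^sub>R v) < quad_obj \<alpha> Q\<^sub>1 x\<^sub>1 x \<and>
        quad_obj \<beta> Q\<^sub>2 x\<^sub>2 (x + s *\<^sub>R v) < quad_obj \<beta> Q\<^sub>2 x\<^sub>2 x"
      using assms(2,3) sym by (intro eventually_conj quad_obj_descent)
    then obtain s where "quad_obj \<alpha> Q\<^sub>1 x\<^sub>1 (x + s *\<^sub>R v) < quad_obj \<alpha> Q\<^sub>1 x\<^sub>1 x"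
      "quad_obj \<beta> Q\<^sub>2 x\<^sub>2 (x + s *\<^sub>R v) < quad_obj \<beta> Q\<^sub>2 x\<^sub>2 x"
      using eventually_happens' trivial_limit_at_right_real by blast
    then show False
      using x unfolding pareto_set_def by (auto dest: less_imp_le)
  qed
  then have par: "norm a *\<^sub>R b = norm b *\<^sub>R a"
    by (simp add: norm_cauchy_schwarz_eq)
  \<comment> \<open>If both vanished, \<open>x\<close> would equal both distinct centers; this keeps
    the denominator of \<open>t\<close> positive.\<close>
  have "a \<noteq> 0 \<or> b \<noteq> 0"
  proof (rule ccontr)
    assume "\<not> (a \<noteq> 0 \<or> b \<noteq> 0)"
    then have "x - x\<^sub>1 = 0" "x\<^sub>2 - x = 0"
      using assms(4,5) unfolding a_def b_def sym_pos_def_def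
      by (metis inner_zero_right less_irrefl)+
    then show False
      using assms(1) by simp
  qed
  then have pos: "norm a + norm b > 0"
    by (auto simp: add_pos_nonneg add_nonneg_pos)
  \<comment> \<open>The weights \<open>1 - t\<close> and \<open>t\<close> are in the ratio of
    \<open>norm b\<close> to \<open>norm a\<close>, which turns \<open>par\<close> into the
    stationarity condition.\<close>
  define t where "t = norm a / (norm a + norm b)"
  have t: "t \<in> {0..1}"
    using pos by (simp add: t_def)
  have "1 - t = norm b / (norm a + norm b)"
    using pos by (simp add: t_def field_simps)
  then have "(1 - t) *\<^sub>R a = inverse (norm a + norm b) *\<^sub>R (norm b *\<^sub>R a)"
    by (simp add: divide_inverse mult.commute)
  also have "\<dots> = t *\<^sub>R b"
    by (simp add: par[symmetric] t_def divide_inverse mult.commute)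
  finally have "x = pareto_curve Q\<^sub>1 Q\<^sub>2 x\<^sub>1 x\<^sub>2 t"
    using pareto_curve_eq_iff[OF assms(4,5) t] by (simp add: a_def b_def)
  with t show ?thesis
    by blast
qed

theorem proposition1:
  fixes x\<^sub>1 x\<^sub>2 :: "real^'n" and \<alpha> \<beta> :: real and Q\<^sub>1 Q\<^sub>2 :: "real^'n^'n"
    and f\<^sub>1 f\<^sub>2 :: "real^'n \<Rightarrow> real" and \<phi> :: "real \<Rightarrow> real^'n"
  assumes "x\<^sub>1 \<noteq> x\<^sub>2" and "\<alpha> > 0" and "\<beta> > 0"
    and "sym_pos_def Q\<^sub>1" and "sym_pos_def Q\<^sub>2"
    and "f\<^sub>1 = quad_obj \<alpha> Q\<^sub>1 x\<^sub>1" and "f\<^sub>2 = quad_obj \<beta> Q\<^sub>2 x\<^sub>2"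
    and "\<phi> = pareto_curve Q\<^sub>1 Q\<^sub>2 x\<^sub>1 x\<^sub>2"
  shows "(\<forall>t\<in>{0..1}. invertible (matrix_mix Q\<^sub>1 Q\<^sub>2 t)) \<and>
    pareto_set f\<^sub>1 f\<^sub>2 = \<phi> ` {0..1} \<and>
    \<phi> differentiable_on {0..1} \<and>
    (\<forall>t\<in>{0..1}.
       (1 - t) *\<^sub>R (Q\<^sub>1 *v (\<phi> t - x\<^sub>1)) = t *\<^sub>R (Q\<^sub>2 *v (x\<^sub>2 - \<phi> t)) \<and>
       t *\<^sub>R (matrix_mix Q\<^sub>1 Q\<^sub>2 t *v vector_derivative \<phi> (at t within {0..1}))
         = Q\<^sub>1 *v (\<phi> t - x\<^sub>1)) \<and>
    path \<phi> \<and> path_image \<phi> = pareto_set f\<^sub>1 f\<^sub>2 \<and>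
    pathstart \<phi> = x\<^sub>1 \<and> pathfinish \<phi> = x\<^sub>2"
proof -
  let ?I = "{0..1} :: real set"
  have eq_iff: "x = \<phi> t \<longleftrightarrow> (1 - t) *\<^sub>R (Q\<^sub>1 *v (x - x\<^sub>1)) = t *\<^sub>R (Q\<^sub>2 *v (x\<^sub>2 - x))"
    if "t \<in> ?I" for t x
    using pareto_curve_eq_iff[OF assms(4,5) that] assms(8) by simp
  have inv: "\<forall>t\<in>?I. invertible (matrix_mix Q\<^sub>1 Q\<^sub>2 t)"
    using assms(4,5) sym_pos_def_matrix_mix sym_pos_def_invertible by blast
  have pareto: "pareto_set f\<^sub>1 f\<^sub>2 = \<phi> ` ?I"
    using pareto_set_in_pareto_curve[OF assms(1-5)] pareto_curve_in_pareto_set[OF assms(2-5)]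
    unfolding assms(6-8) by (intro equalityI subsetI) auto
  have deriv: "\<exists>z. (\<phi> has_vector_derivative z) (at t within ?I) \<and>
      matrix_mix Q\<^sub>1 Q\<^sub>2 t *v z = Q\<^sub>1 *v (\<phi> t - x\<^sub>1) + Q\<^sub>2 *v (x\<^sub>2 - \<phi> t)"
    if "t \<in> ?I" for t
    using pareto_curve_has_vector_derivative[OF assms(4,5) that] unfolding assms(8) .
  have diff: "\<phi> differentiable_on ?I"
    unfolding differentiable_on_def using deriv differentiableI_vector by blast
  have stat: "(1 - t) *\<^sub>R (Q\<^sub>1 *v (\<phi> t - x\<^sub>1)) = t *\<^sub>R (Q\<^sub>2 *v (x\<^sub>2 - \<phi> t))" if "t \<in> ?I" for t
    using eq_iff[OF that] by blast
  have ode: "t *\<^sub>R (matrix_mix Q\<^sub>1 Q\<^sub>2 t *v vector_derivative \<phi> (at t within ?I)) = Q\<^sub>1 *v (\<phi> t - x\<^sub>1)"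
    if t: "t \<in> ?I" for t
  proof -
    obtain z where z: "(\<phi> has_vector_derivative z) (at t within ?I)"
      "matrix_mix Q\<^sub>1 Q\<^sub>2 t *v z = Q\<^sub>1 *v (\<phi> t - x\<^sub>1) + Q\<^sub>2 *v (x\<^sub>2 - \<phi> t)"
      using deriv[OF t] by blast
    \<comment> \<open>Derivatives within a nondegenerate interval are unique, also at its
      endpoints.\<close>
    have "vector_derivative \<phi> (at t within ?I) = z"
      using z(1) t by (intro vector_derivative_within_closed_interval) auto
    \<comment> \<open>Stationarity trades the \<open>Q\<^sub>2\<close> term for a
      \<open>Q\<^sub>1\<close> term, and the coefficients \<open>t\<close> and \<open>1 - t\<close>
      then add up to one.\<close>
    then have "t *\<^sub>R (matrix_mix Q\<^sub>1 Q\<^sub>2 t *v vector_derivative \<phi> (at t within ?I)) =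
        t *\<^sub>R (Q\<^sub>1 *v (\<phi> t - x\<^sub>1)) + (1 - t) *\<^sub>R (Q\<^sub>1 *v (\<phi> t - x\<^sub>1))"
      by (simp only: z(2) stat[OF t] scaleR_add_right)
    then show ?thesis
      by (simp flip: scaleR_add_left)
  qed
  have path: "path \<phi>"
    unfolding path_def by (rule differentiable_imp_continuous_on[OF diff])
  \<comment> \<open>With \<open>x\<^sub>1\<close> at parameter 0 and \<open>x\<^sub>2\<close> at
    parameter 1, both sides of the stationarity condition are zero.\<close>
  have ends: "pathstart \<phi> = x\<^sub>1" "pathfinish \<phi> = x\<^sub>2"
    using eq_iff[of 0 x\<^sub>1] eq_iff[of 1 x\<^sub>2] by (simp_all add: pathstart_def pathfinish_def)
  have image: "path_image \<phi> = pareto_set f\<^sub>1 f\<^sub>2"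
    by (simp add: path_image_def pareto)
  show ?thesis
    by (intro conjI inv pareto diff path image ends ballI stat ode)
qed

end
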